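(* Let $n\geq 1$ and let $m,k$ be integers with $m\leq k$. Put $a=\min\{|m|,|k|\}$ and $b=\max\{|m|,|k|\}$. If $mk>0$, then \[(-1)^{\min\{|m|,k\}}\sum_{j=m}^{k}(-1)^j\overline{p}(n-j^2)=op_{2,1}(n,a)+(-1)^{m+k}op_{2,1}(n,b+1),\] and if $mk\leq 0$, then \[(-1)^{\min\{|m|,k\}}\sum_{j=m}^{k}(-1)^j\overline{p}(n-j^2)=op_{2,1}(n,a+1)+(-1)^{m+k}op_{2,1}(n,b+1).\]
   Context: An overpartition of $n$ is a partition of $n$ in which the last occurrence of each part size may be overlined. $\overline{p}(n)$ denotes the number of overpartitions of $n$, with $\overline{p}(0)=1$ and $\overline{p}(n)=0$ for $n<0$. For an overpartition $\pi$, $\overline{mex}_{2,1}(\pi)$ denotes the smallest positive odd integer that does not occur as a non-overlined part of $\pi$. For $n\geq 1$ and $k\geq 0$, $op_{2,1}(n,k)$ denotes the number of overpartitions $\pi$ of $n$ such that $\overline{mex}_{2,1}(\pi)\geq 2k+1$ and $\overline{mex}_{2,1}(\pi)\equiv 2k+1 \pmod 4$. *)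

theory Defs
  imports Complex_Main "HOL-Library.Multiset"
begin

text \<open>
  An overpartition is encoded as a pair of the multiset of all its parts (overlined or not) and
  the set of those part sizes whose last occurrence is overlined.
\<close>

type_synonym overpartition = "nat multiset \<times> nat set"

definition overpartitions :: "nat \<Rightarrow> overpartition set" where
  "overpartitions n =
     {(M, S). (\<forall>x \<in># M. 0 < x) \<and> sum_mset M = n \<and> S \<subseteq> set_mset M}"

lemma overpartitions_0: "overpartitions 0 = {({#}, {})}"
proof -
  have "M = {#}" if "\<forall>x \<in># M. 0 < x" "sum_mset M = 0" for M :: "nat multiset"
    using that by (cases M) auto
  then show ?thesis by (fastforce simp del: sum_mset_0_iff simp: overpartitions_def)
qed

lemma finite_overpartitions: "finite (overpartitions n)"
proof -
  let ?L = "{xs. set xs \<subseteq> {..n} \<and> length xs \<le> n}"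
  have size_le: "size M \<le> sum_mset M" if "\<forall>x \<in># M. 0 < x" for M :: "nat multiset"
    using that by (induction M) auto
  have elem_le: "x \<le> sum_mset M" if "x \<in># M" for x and M :: "nat multiset"
    using that by (metis le_add1 multi_member_split sum_mset.add_mset)
  have "overpartitions n \<subseteq> mset ` ?L \<times> Pow {..n}"
  proof
    fix p assume p: "p \<in> overpartitions n"
    obtain M S where MS: "p = (M, S)" by (cases p)
    obtain xs where xs: "M = mset xs" by (metis ex_mset)
    have pos: "\<forall>x \<in># M. 0 < x" and sum: "sum_mset M = n" and S: "S \<subseteq> set_mset M"
      using p MS by (auto simp: overpartitions_def)
    have "set_mset M \<subseteq> {..n}" using elem_le[of _ M] sum by auto
    moreover have "size M \<le> n" using size_le[OF pos] sum by simp
    ultimately have "xs \<in> ?L" "S \<in> Pow {..n}" using S xs by auto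
    then show "p \<in> mset ` ?L \<times> Pow {..n}" using MS xs by auto
  qed
  moreover have "finite ?L" by (rule finite_lists_length_le) simp
  ultimately show ?thesis by (meson finite_Pow_iff finite_SigmaI finite_atMost finite_imageI finite_subset)
qed

definition pbar :: "int \<Rightarrow> nat" where
  "pbar n = (if n < 0 then 0 else card (overpartitions (nat n)))"

text \<open>Exactly one copy of each overlined size is overlined; the remaining copies are not.\<close>

definition nonoverlined_parts :: "overpartition \<Rightarrow> nat multiset" where
  "nonoverlined_parts \<pi> = fst \<pi> - mset_set (snd \<pi>)"

definition mexbar21 :: "overpartition \<Rightarrow> nat" where
  "mexbar21 \<pi> = (LEAST i. 0 < i \<and> odd i \<and> i \<notin># nonoverlined_parts \<pi>)"

definition op21 :: "nat \<Rightarrow> nat \<Rightarrow> nat" where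
  "op21 n k = card {\<pi> \<in> overpartitions n.
     mexbar21 \<pi> \<ge> 2 * k + 1 \<and> mexbar21 \<pi> mod 4 = (2 * k + 1) mod 4}"

end

theory Submission
  imports Defs "HOL-Computational_Algebra.Formal_Power_Series"
begin

text \<open>
  Removing one copy of each of 1, 3, ..., 2k - 1 from the non-overlined parts shows that
  pbar (n - k^2) counts the overpartitions of n with mex at least 2k + 1. As the mex is odd, this
  says op21 n k + op21 n (k + 1) = pbar (n - k^2), so alternating sums over intervals of positive
  (or negative) j telescope. Across j = 0 one also needs op21 n 0 = op21 n 1, which is equivalent
  to Gauss's identity: the generating function of pbar is the inverse of the sum of (-1)^j q^(j^2)
  over all integers j. This follows modulo q^(2N+1) from the finite identity
  (q; q^2)_N^2 = sum of (-1)^j q^(j^2) [2N choose N+j] at base q^2 over |j| <= N, a specialisation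
  of the q-binomial theorem.
\<close>

section \<open>Gaussian binomials, the q-binomial theorem and a finite form of Gauss's
  identity\<close>

text \<open>The Gaussian binomial with base \<open>Q\<close>, given by the q-Pascal rule so that no
  division occurs and any commutative ring is allowed.\<close>

fun qbinom :: "'a::comm_ring_1 \<Rightarrow> nat \<Rightarrow> nat \<Rightarrow> 'a" where
  "qbinom Q n 0 = 1"
| "qbinom Q 0 (Suc k) = 0"
| "qbinom Q (Suc n) (Suc k) = qbinom Q n k + Q ^ Suc k * qbinom Q n (Suc k)"

text \<open>The q-Pochhammer symbol (Q; Q)_n.\<close>

definition qpoch :: "'a::comm_ring_1 \<Rightarrow> nat \<Rightarrow> 'a" where
  "qpoch Q n = (\<Prod>i = 1..n. (1 - Q ^ i))"

lemma qpoch_0 [simp]: "qpoch Q 0 = 1"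
  by (simp add: qpoch_def)

lemma qpoch_Suc: "qpoch Q (Suc n) = qpoch Q n * (1 - Q ^ Suc n)"
  by (simp add: qpoch_def)

lemma qbinom_eq_0: "n < k \<Longrightarrow> qbinom Q n k = 0"
  by (induction Q n k rule: qbinom.induct) auto

text \<open>The quotient formula for Gaussian binomials with denominators cleared. Both terms of the
  Pascal rule yield the factor \<open>qpoch Q n\<close>, and (1 - Q^(k+1)) + Q^(k+1) (1 - Q^(n-k)) =
  1 - Q^(n+1).\<close>

lemma qbinom_qpoch: "k \<le> n \<Longrightarrow> qbinom Q n k * qpoch Q k * qpoch Q (n - k) = qpoch Q n"
proof (induction Q n k rule: qbinom.induct)
  case (3 Q n k)
  show ?case
  proof (cases "k = n")
    case True
    then show ?thesis using 3 by (simp add: qbinom_eq_0 qpoch_Suc mult.assoc[symmetric])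
  next
    case False
    with 3 have k: "k < n" by simp
    then have d: "n - k = Suc (n - Suc k)" and e: "Suc k + (n - k) = Suc n" by auto
    have 1: "qbinom Q n k * qpoch Q k * qpoch Q (n - k) = qpoch Q n"
      and 2: "qbinom Q n (Suc k) * qpoch Q (Suc k) * qpoch Q (n - Suc k) = qpoch Q n"
      using 3 k by auto
    have 3: "qpoch Q (n - k) = qpoch Q (n - Suc k) * (1 - Q ^ (n - k))"
      unfolding d qpoch_Suc ..
    have "qbinom Q (Suc n) (Suc k) * qpoch Q (Suc k) * qpoch Q (Suc n - Suc k)
      = qbinom Q n k * qpoch Q (Suc k) * qpoch Q (n - k)
      + Q ^ Suc k * (qbinom Q n (Suc k) * qpoch Q (Suc k) * qpoch Q (n - k))"
      by (simp add: distrib_right mult.assoc)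
    also have "qbinom Q n (Suc k) * qpoch Q (Suc k) * qpoch Q (n - k) = qpoch Q n * (1 - Q ^ (n - k))"
      by (subst 3) (simp only: 2 mult.assoc[symmetric])
    also have "qbinom Q n k * qpoch Q (Suc k) * qpoch Q (n - k) = qpoch Q n * (1 - Q ^ Suc k)"
      unfolding 1[symmetric] qpoch_Suc by (simp only: mult_ac)
    also have "qpoch Q n * (1 - Q ^ Suc k) + Q ^ Suc k * (qpoch Q n * (1 - Q ^ (n - k)))
       = qpoch Q n * (1 - Q ^ (Suc k + (n - k)))"
      unfolding power_add by (simp add: algebra_simps)
    finally show ?thesis unfolding e by (simp add: qpoch_Suc)
  qed
qed auto

text \<open>Splitting off the factor with i = 0 leaves the shorter product with \<open>x * Q\<close>
  in place of \<open>x\<close>, hence the induction for arbitrary \<open>x\<close>. The coefficients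
  of x^(k+1) y^(n-k) then combine by the Pascal rule.\<close>

lemma qbinom_theorem:
  fixes x y Q :: "'a::comm_ring_1"
  shows "(\<Prod>i<n. (y + x * Q ^ i)) = (\<Sum>k\<le>n. Q ^ (k choose 2) * qbinom Q n k * x ^ k * y ^ (n - k))"
proof (induction n arbitrary: x)
  case (Suc n)
  let ?t = "\<lambda>k. Q ^ ((k choose 2) + k) * qbinom Q n k * x ^ k"
  have z: "(0 choose 2) = (0 :: nat)"
    by (simp add: numeral_2_eq_2)
  have c: "(Suc k choose 2) = (k choose 2) + k" for k
    by (simp add: numeral_2_eq_2)
  have "(\<Prod>i<Suc n. (y + x * Q ^ i)) = (y + x) * (\<Prod>i<n. (y + x * Q * Q ^ i))"
    by (subst prod.lessThan_Suc_shift) (simp add: mult.assoc)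
  also have "(\<Prod>i<n. (y + x * Q * Q ^ i)) = (\<Sum>k\<le>n. ?t k * y ^ (n - k))"
    unfolding Suc by (simp add: power_add power_mult_distrib mult_ac)
  also have "(y + x) * \<dots> = (\<Sum>k\<le>n. ?t k * (y ^ (n - k) * y)) + (\<Sum>k\<le>n. ?t k * y ^ (n - k) * x)"
    by (simp add: distrib_right sum_distrib_left sum.distrib mult_ac)
  also have "(\<Sum>k\<le>n. ?t k * (y ^ (n - k) * y)) = (\<Sum>k\<le>n. ?t k * y ^ (Suc n - k))"
    by (simp add: Suc_diff_le mult.commute)
  also have "(\<Sum>k\<le>n. ?t k * y ^ (Suc n - k)) = (\<Sum>k\<le>Suc n. ?t k * y ^ (Suc n - k))"
    by (simp add: qbinom_eq_0)
  also have "\<dots> = y ^ Suc n + (\<Sum>k\<le>n. ?t (Suc k) * y ^ (n - k))"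
    by (subst sum.atMost_Suc_shift) (simp add: z)
  also have "y ^ Suc n + (\<Sum>k\<le>n. ?t (Suc k) * y ^ (n - k)) + (\<Sum>k\<le>n. ?t k * y ^ (n - k) * x)
     = y ^ Suc n + (\<Sum>k\<le>n. Q ^ (Suc k choose 2) * qbinom Q (Suc n) (Suc k) * x ^ Suc k * y ^ (n - k))"
    by (simp add: sum.distrib[symmetric] c power_add algebra_simps)
  also have "\<dots> = (\<Sum>k\<le>Suc n. Q ^ (k choose 2) * qbinom Q (Suc n) k * x ^ k * y ^ (Suc n - k))"
    by (simp only: sum.atMost_Suc_shift z) simp
  finally show ?case .
qed (simp add: numeral_2_eq_2)

text \<open>
  The q-binomial theorem at base \<open>q\<^sup>2\<close> with \<open>x = -1\<close> and \<open>y = q ^ (2 * N - 1)\<close>, divided by the common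
  power of \<open>q\<close>. The summation index is \<open>k = N + j\<close>.
\<close>

lemma finite_Jacobi:
  fixes q :: "'a::idom"
  assumes "q \<noteq> 0" "N > 0"
  shows "(\<Prod>i<N. (1 - q ^ (2 * i + 1)))\<^sup>2
    = (\<Sum>k\<le>2 * N. (-1) ^ (N + k) * q ^ nat ((int k - int N)\<^sup>2) * qbinom (q\<^sup>2) (2 * N) k)"
proof -
  define P where "P = (\<Prod>i<N. (1 - q ^ (2 * i + 1)))"
  \<comment> \<open>The common power of q: the first N factors contribute the exponents 2i, with sum
    N (N - 1), and each of the last N contributes 2N - 1.\<close>
  define e where "e = N * (N - 1) + N * (2 * N - 1)"
  \<comment> \<open>Completing the square: k (k - 1) + (2N - 1) (2N - k) = 3 N^2 - 2N + (k -
    N)^2.\<close>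
  have ex: "2 * (k choose 2) + (2 * N - 1) * (2 * N - k) = e + nat ((int k - int N)\<^sup>2)" if "k \<le> 2 * N" for k
  proof -
    have "2 * (k choose 2) = k * (k - 1)"
      unfolding choose_two by (cases k) (auto intro!: dvd_mult_div_cancel)
    then have 1: "int (2 * (k choose 2)) = int k * (int k - 1)"
      by (cases k) (auto simp: algebra_simps)
    have 2: "int ((2 * N - 1) * (2 * N - k)) = (2 * int N - 1) * (2 * int N - int k)"
      unfolding of_nat_mult using that \<open>N > 0\<close> by (subst (1 2) of_nat_diff) auto
    have 3: "int e = int N * (int N - 1) + int N * (2 * int N - 1)"
      unfolding e_def of_nat_mult of_nat_add using \<open>N > 0\<close> by (subst (1 2) of_nat_diff) auto
    have "int (2 * (k choose 2) + (2 * N - 1) * (2 * N - k)) = int (e + nat ((int k - int N)\<^sup>2))"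
      unfolding of_nat_add 1 2 3 nat_0_le[OF zero_le_power2] by (simp add: algebra_simps power2_eq_square)
    then show ?thesis by linarith
  qed
  have s: "(\<Sum>i<N. 2 * i) = N * (N - 1)"
  proof (induction N)
    case (Suc N)
    then show ?case by (cases N) auto
  qed simp
  \<comment> \<open>For i < N the lower power of q is q^(2i), and pulling it out costs a sign; for i
    >= N it is q^(2N-1). Each half leaves a copy of \<open>P\<close>, the first in reversed
    order.\<close>
  have "(\<Prod>i<2 * N. (q ^ (2 * N - 1) + (-1) * (q\<^sup>2) ^ i))
      = (\<Prod>i<N. (q ^ (2 * N - 1) - q ^ (2 * i))) * (\<Prod>i<N. (q ^ (2 * N - 1) - q ^ (2 * (N + i))))"
  proof -
    have "{..<2 * N} = {..<N} \<union> {N..<2 * N}" by auto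
    moreover have "(\<Prod>i\<in>{N..<2 * N}. (q ^ (2 * N - 1) - q ^ (2 * i))) = (\<Prod>i<N. (q ^ (2 * N - 1) - q ^ (2 * (N + i))))"
      by (rule prod.reindex_bij_witness[of _ "\<lambda>i. N + i" "\<lambda>i. i - N"]) auto
    ultimately show ?thesis
      by (simp add: prod.union_disjoint power_mult[symmetric] ivl_disj_int)
  qed
  also have "(\<Prod>i<N. (q ^ (2 * N - 1) - q ^ (2 * i))) = (\<Prod>i<N. (- 1) * q ^ (2 * i) * (1 - q ^ (2 * (N - Suc i) + 1)))"
  proof (rule prod.cong)
    fix i assume "i \<in> {..<N}"
    then have "2 * N - 1 = 2 * i + (2 * (N - Suc i) + 1)" by auto
    then show "q ^ (2 * N - 1) - q ^ (2 * i) = (- 1) * q ^ (2 * i) * (1 - q ^ (2 * (N - Suc i) + 1))"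
      by (simp only: power_add) (simp add: algebra_simps)
  qed simp
  also have "\<dots> = (-1) ^ N * q ^ (N * (N - 1)) * P"
  proof -
    have "(\<Prod>i<N. (1 - q ^ (2 * (N - Suc i) + 1))) = P"
      unfolding P_def by (rule prod.nat_diff_reindex)
    then show ?thesis
      by (simp only: prod.distrib prod_constant power_sum[symmetric] s card_lessThan)
  qed
  also have "(\<Prod>i<N. (q ^ (2 * N - 1) - q ^ (2 * (N + i)))) = (\<Prod>i<N. q ^ (2 * N - 1) * (1 - q ^ (2 * i + 1)))"
  proof (rule prod.cong)
    fix i
    have "2 * (N + i) = (2 * N - 1) + (2 * i + 1)" using \<open>N > 0\<close> by auto
    then show "q ^ (2 * N - 1) - q ^ (2 * (N + i)) = q ^ (2 * N - 1) * (1 - q ^ (2 * i + 1))"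
      by (simp only: power_add) (simp add: algebra_simps)
  qed simp
  also have "\<dots> = q ^ (N * (2 * N - 1)) * P"
    by (simp add: prod.distrib P_def power_mult[symmetric] mult.commute del: power_Suc)
  finally have L: "(\<Prod>i<2 * N. (q ^ (2 * N - 1) + (-1) * (q\<^sup>2) ^ i)) = q ^ e * ((-1) ^ N * P\<^sup>2)"
    by (simp add: e_def power_add power2_eq_square mult_ac)
  have "q ^ e * ((-1) ^ N * P\<^sup>2)
    = (\<Sum>k\<le>2 * N. (q\<^sup>2) ^ (k choose 2) * qbinom (q\<^sup>2) (2 * N) k * (-1) ^ k * (q ^ (2 * N - 1)) ^ (2 * N - k))"
    unfolding L[symmetric] by (rule qbinom_theorem)
  also have "\<dots> = (\<Sum>k\<le>2 * N. q ^ e * ((-1) ^ k * q ^ nat ((int k - int N)\<^sup>2) * qbinom (q\<^sup>2) (2 * N) k))"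
  proof (rule sum.cong)
    fix k assume "k \<in> {..2 * N}"
    then have "(q\<^sup>2) ^ (k choose 2) * (q ^ (2 * N - 1)) ^ (2 * N - k) = q ^ e * q ^ nat ((int k - int N)\<^sup>2)"
      by (simp only: power_mult[symmetric] power_add[symmetric] ex atMost_iff)
    then show "(q\<^sup>2) ^ (k choose 2) * qbinom (q\<^sup>2) (2 * N) k * (-1) ^ k * (q ^ (2 * N - 1)) ^ (2 * N - k)
       = q ^ e * ((-1) ^ k * q ^ nat ((int k - int N)\<^sup>2) * qbinom (q\<^sup>2) (2 * N) k)"
      by (simp add: mult_ac)
  qed simp
  finally have "(-1) ^ N * P\<^sup>2 = (\<Sum>k\<le>2 * N. (-1) ^ k * q ^ nat ((int k - int N)\<^sup>2) * qbinom (q\<^sup>2) (2 * N) k)"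
    using \<open>q \<noteq> 0\<close> by (simp add: sum_distrib_left[symmetric])
  then have "(-1) ^ N * ((-1) ^ N * P\<^sup>2) = (\<Sum>k\<le>2 * N. (-1) ^ (N + k) * q ^ nat ((int k - int N)\<^sup>2) * qbinom (q\<^sup>2) (2 * N) k)"
    by (simp add: sum_distrib_left power_add mult.assoc)
  moreover have "(-1) ^ N * ((-1) ^ N * P\<^sup>2) = P\<^sup>2"
    by (simp add: mult.assoc[symmetric] power_add[symmetric])
  ultimately show ?thesis unfolding P_def by simp
qed

section \<open>Overpartitions as independent pairs, with a recursion on the largest size\<close>

text \<open>
  Here the first component holds the non-overlined parts only, so that the two components are
  independent of each other; \<open>L\<close> bounds the part sizes.
\<close>

definition split_overpartitions :: "nat \<Rightarrow> nat \<Rightarrow> overpartition set" where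
  "split_overpartitions L n =
     {(N, S). set_mset N \<subseteq> {0<..L} \<and> S \<subseteq> {0<..L} \<and> sum_mset N + \<Sum>S = n}"

lemma member_le_sum_mset: "x \<in># M \<Longrightarrow> x \<le> sum_mset M" for x :: nat
  by (metis le_add1 multi_member_split sum_mset.add_mset)

lemma sum_mset_mset_set: "sum_mset (mset_set S) = \<Sum>S"
  by (simp add: sum_unfold_sum_mset)

lemma mset_set_subseteq_iff:
  assumes "finite X"
  shows "mset_set X \<subseteq># N \<longleftrightarrow> X \<subseteq> set_mset N"
proof
  assume "X \<subseteq> set_mset N"
  then have "mset_set X \<subseteq># mset_set (set_mset N)"
    by (simp add: subset_imp_msubset_mset_set)
  also have "\<dots> \<subseteq># N" by (rule mset_set_set_mset_msubset)
  finally show "mset_set X \<subseteq># N" .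
qed (use assms set_mset_mono in fastforce)

text \<open>Adding the overlined copies back undoes their removal. Since no part exceeds the sum,
  the bound \<open>L\<close> excludes nothing when \<open>n \<le> L\<close>.\<close>

lemma bij_betw_split:
  assumes "n \<le> L"
  shows "bij_betw (\<lambda>\<pi>. (nonoverlined_parts \<pi>, snd \<pi>)) (overpartitions n) (split_overpartitions L n)"
proof (rule bij_betw_byWitness[where f' = "\<lambda>(N, S). (N + mset_set S, S)"])
  have sub: "mset_set S \<subseteq># M" if "S \<subseteq> set_mset M" for S and M :: "nat multiset"
    using that finite_subset[OF that] by (simp add: mset_set_subseteq_iff)
  show "\<forall>\<pi>\<in>overpartitions n. (case (nonoverlined_parts \<pi>, snd \<pi>) of (N, S) \<Rightarrow> (N + mset_set S, S)) = \<pi>"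
    by (auto simp: overpartitions_def nonoverlined_parts_def sub)
  show "\<forall>p\<in>split_overpartitions L n. (nonoverlined_parts (case p of (N, S) \<Rightarrow> (N + mset_set S, S)),
      snd (case p of (N, S) \<Rightarrow> (N + mset_set S, S))) = p"
    by (auto simp: nonoverlined_parts_def)
  show "(\<lambda>\<pi>. (nonoverlined_parts \<pi>, snd \<pi>)) ` overpartitions n \<subseteq> split_overpartitions L n"
  proof clarify
    fix M S assume "(M, S) \<in> overpartitions n"
    then have M: "\<forall>x\<in>#M. 0 < x" "sum_mset M = n" and S: "S \<subseteq> set_mset M"
      by (auto simp: overpartitions_def)
    have bd: "set_mset M \<subseteq> {0<..L}" using M member_le_sum_mset[of _ M] \<open>n \<le> L\<close> by force
    have "sum_mset (M - mset_set S) + \<Sum>S = sum_mset (M - mset_set S + mset_set S)"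
      by (simp add: sum_mset_mset_set)
    also have "\<dots> = n" using M sub[OF S] by simp
    finally show "(nonoverlined_parts (M, S), snd (M, S)) \<in> split_overpartitions L n"
      using bd S by (auto simp: split_overpartitions_def nonoverlined_parts_def dest!: in_diffD)
  qed
  show "(\<lambda>(N, S). (N + mset_set S, S)) ` split_overpartitions L n \<subseteq> overpartitions n"
  proof clarify
    fix N S assume "(N, S) \<in> split_overpartitions L n"
    then have *: "set_mset N \<subseteq> {0<..L}" "S \<subseteq> {0<..L}" "sum_mset N + \<Sum>S = n"
      by (auto simp: split_overpartitions_def)
    then have "finite S" using finite_subset by blast
    then show "(N + mset_set S, S) \<in> overpartitions n"
      using * by (auto simp: overpartitions_def sum_mset_mset_set)
  qed
qed

lemma card_split_overpartitions: "n \<le> L \<Longrightarrow> card (split_overpartitions L n) = pbar (int n)"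
  using bij_betw_same_card[OF bij_betw_split] by (simp add: pbar_def)

lemma split_overpartitions_mono: "L \<le> L' \<Longrightarrow> split_overpartitions L n \<subseteq> split_overpartitions L' n"
  by (fastforce simp: split_overpartitions_def)

lemma finite_split_overpartitions: "finite (split_overpartitions L n)"
proof -
  have "finite (split_overpartitions (max n L) n)"
    using bij_betw_finite[OF bij_betw_split[of n "max n L"]] finite_overpartitions by simp
  then show ?thesis by (rule finite_subset[rotated]) (simp add: split_overpartitions_mono)
qed

lemma split_overpartitions_0: "split_overpartitions 0 n = (if n = 0 then {({#}, {})} else {})"
  by (auto simp: split_overpartitions_def)

text \<open>The size \<open>Suc L\<close> occurs non-overlined (\<open>A\<close>: remove one such
  copy), only overlined (\<open>B\<close>: drop it), or not at all (\<open>C\<close>). This is the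
  coefficient form of multiplying the generating function by (1 + q^(L+1)) / (1 - q^(L+1)).\<close>

lemma card_split_overpartitions_Suc:
  "card (split_overpartitions (Suc L) n) =
     card (split_overpartitions L n)
     + (if Suc L \<le> n then card (split_overpartitions (Suc L) (n - Suc L))
                         + card (split_overpartitions L (n - Suc L)) else 0)"
proof -
  let ?X = split_overpartitions and ?l = "Suc L"
  define A where "A = {p \<in> ?X ?l n. ?l \<in># fst p}"
  define B where "B = {p \<in> ?X ?l n. ?l \<notin># fst p \<and> ?l \<in> snd p}"
  define C where "C = {p \<in> ?X ?l n. ?l \<notin># fst p \<and> ?l \<notin> snd p}"
  have fin: "finite A" "finite B" "finite C"
    by (simp_all add: A_def B_def C_def finite_split_overpartitions)
  have "?X ?l n = A \<union> (B \<union> C)" by (auto simp: A_def B_def C_def)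
  moreover have "A \<inter> (B \<union> C) = {}" "B \<inter> C = {}" by (auto simp: A_def B_def C_def)
  ultimately have 1: "card (?X ?l n) = card A + (card B + card C)"
    using fin by (simp add: card_Un_disjoint)
  have atl: "{0<..?l} = insert ?l {0<..L}" by auto
  have C: "C = ?X L n"
    by (auto simp: C_def split_overpartitions_def atl)
  show ?thesis
  proof (cases "?l \<le> n")
    case True
    have "bij_betw (\<lambda>(N, S). (add_mset ?l N, S)) (?X ?l (n - ?l)) A"
    proof (rule bij_betw_byWitness[where f' = "\<lambda>(N, S). (N - {#?l#}, S)"])
      show "(\<lambda>(N, S). (N - {#?l#}, S)) ` A \<subseteq> ?X ?l (n - ?l)"
        using True by (auto simp: A_def split_overpartitions_def sum_mset_diff member_le_sum_mset dest!: in_diffD)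
    qed (use True in \<open>auto simp: A_def split_overpartitions_def\<close>)
    moreover have "bij_betw (\<lambda>(N, S). (N, insert ?l S)) (?X L (n - ?l)) B"
    proof (rule bij_betw_byWitness[where f' = "\<lambda>(N, S). (N, S - {?l})"])
      have f: "finite S" if "S \<subseteq> {0<..l}" for S and l :: nat using that finite_subset by blast
      show "\<forall>p\<in>?X L (n - ?l). (case case p of (N, S) \<Rightarrow> (N, insert ?l S) of (N, S) \<Rightarrow> (N, S - {?l})) = p"
        by (fastforce simp: split_overpartitions_def)
      show "\<forall>p\<in>B. (case case p of (N, S) \<Rightarrow> (N, S - {?l}) of (N, S) \<Rightarrow> (N, insert ?l S)) = p"
        by (auto simp: B_def)
      show "(\<lambda>(N, S). (N, insert ?l S)) ` ?X L (n - ?l) \<subseteq> B"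
      proof clarify
        fix N S assume "(N, S) \<in> ?X L (n - ?l)"
        then have *: "set_mset N \<subseteq> {0<..L}" "S \<subseteq> {0<..L}" "sum_mset N + \<Sum>S = n - ?l"
          by (auto simp: split_overpartitions_def)
        then have "?l \<notin> S" "?l \<notin># N" "finite S" using f by force+
        then show "(N, insert ?l S) \<in> B"
          using * True by (auto simp: B_def split_overpartitions_def)
      qed
      show "(\<lambda>(N, S). (N, S - {?l})) ` B \<subseteq> ?X L (n - ?l)"
      proof clarify
        fix N S assume "(N, S) \<in> B"
        then have *: "set_mset N \<subseteq> {0<..?l}" "S \<subseteq> {0<..?l}" "sum_mset N + \<Sum>S = n" "?l \<notin># N" "?l \<in> S"
          by (auto simp: B_def split_overpartitions_def)
        then have "\<Sum>S = ?l + \<Sum>(S - {?l})" using sum.remove[of S ?l id] f by simp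
        then show "(N, S - {?l}) \<in> ?X L (n - ?l)"
          using * by (auto simp: split_overpartitions_def atl)
      qed
    qed
    ultimately show ?thesis using 1 C True by (simp add: bij_betw_same_card[symmetric])
  next
    case False
    have "\<not> ?l \<in># N" "\<not> ?l \<in> S" if "(N, S) \<in> ?X ?l n" for N S
    proof -
      from that have *: "S \<subseteq> {0<..?l}" "sum_mset N + \<Sum>S = n" by (auto simp: split_overpartitions_def)
      show "\<not> ?l \<in># N" using member_le_sum_mset[of ?l N] * False by auto
      have "finite S" using * finite_subset by blast
      then show "\<not> ?l \<in> S" using member_le_sum[of ?l S id] * False by auto
    qed
    then have "A = {}" "B = {}" by (auto simp: A_def B_def)
    then show ?thesis using 1 C False by simp
  qed
qed

section \<open>Odd parts, the mex and the two-term relation for \<open>op21\<close>\<close>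

definition odd_parts :: "nat \<Rightarrow> nat multiset" where
  "odd_parts k = image_mset (\<lambda>i. 2 * i + 1) (mset_set {..<k})"

lemma sum_odd_parts: "sum_mset (odd_parts k) = k\<^sup>2"
  by (induction k) (auto simp: odd_parts_def lessThan_Suc power2_eq_square)

lemma odd_parts_subseteq_iff: "odd_parts k \<subseteq># N \<longleftrightarrow> (\<forall>i<k. 2 * i + 1 \<in># N)"
proof -
  have "odd_parts k = mset_set ((\<lambda>i. 2 * i + 1) ` {..<k})"
    unfolding odd_parts_def by (rule image_mset_mset_set) (auto simp: inj_on_def)
  then show ?thesis by (auto simp: mset_set_subseteq_iff)
qed

lemma mexbar21:
  "odd (mexbar21 \<pi>)"
  "2 * k + 1 \<le> mexbar21 \<pi> \<longleftrightarrow> (\<forall>i<k. 2 * i + 1 \<in># nonoverlined_parts \<pi>)"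
proof -
  let ?P = "\<lambda>i. 0 < i \<and> odd i \<and> i \<notin># nonoverlined_parts \<pi>"
  \<comment> \<open>A witness that makes \<open>LEAST\<close> meaningful: an odd number larger than
    the sum, hence larger than every part.\<close>
  have "2 * sum_mset (nonoverlined_parts \<pi>) + 1 \<notin># nonoverlined_parts \<pi>"
    using member_le_sum_mset by fastforce
  then have "?P (2 * sum_mset (nonoverlined_parts \<pi>) + 1)" by simp
  then have L: "?P (mexbar21 \<pi>)" unfolding mexbar21_def by (rule LeastI)
  then show o: "odd (mexbar21 \<pi>)" by simp
  show "2 * k + 1 \<le> mexbar21 \<pi> \<longleftrightarrow> (\<forall>i<k. 2 * i + 1 \<in># nonoverlined_parts \<pi>)"
  proof
    assume k: "2 * k + 1 \<le> mexbar21 \<pi>"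
    show "\<forall>i<k. 2 * i + 1 \<in># nonoverlined_parts \<pi>"
    proof (intro allI impI)
      fix i assume "i < k"
      then have "2 * i + 1 < (LEAST i. ?P i)" using k by (simp add: mexbar21_def)
      from not_less_Least[OF this] show "2 * i + 1 \<in># nonoverlined_parts \<pi>" by simp
    qed
  next
    assume a: "\<forall>i<k. 2 * i + 1 \<in># nonoverlined_parts \<pi>"
    obtain j where "mexbar21 \<pi> = 2 * j + 1" using o by (rule oddE)
    then show "2 * k + 1 \<le> mexbar21 \<pi>" using a L by (auto simp: not_less[symmetric])
  qed
qed

text \<open>The condition on the mex concerns only the non-overlined component, so the parts 1, 3,
  ..., 2k - 1 can be taken out, and put back, without touching the overlined sizes.\<close>

lemma card_mexbar21_ge:
  "card {\<pi> \<in> overpartitions n. 2 * k + 1 \<le> mexbar21 \<pi>} = pbar (int n - int k ^ 2)"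
proof -
  let ?s = "\<lambda>\<pi>. (nonoverlined_parts \<pi>, snd \<pi>)"
  define A where "A = {p \<in> split_overpartitions n n. odd_parts k \<subseteq># fst p}"
  have b: "bij_betw ?s (overpartitions n) (split_overpartitions n n)"
    by (rule bij_betw_split) simp
  have "?s ` {\<pi> \<in> overpartitions n. 2 * k + 1 \<le> mexbar21 \<pi>} = A"
    unfolding A_def bij_betw_imp_surj_on[OF b, symmetric]
    by (auto simp only: mexbar21(2) odd_parts_subseteq_iff fst_conv image_iff mem_Collect_eq)
  then have "bij_betw ?s {\<pi> \<in> overpartitions n. 2 * k + 1 \<le> mexbar21 \<pi>} A"
    by (intro bij_betw_subset[OF b]) auto
  then have 1: "card {\<pi> \<in> overpartitions n. 2 * k + 1 \<le> mexbar21 \<pi>} = card A"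
    by (rule bij_betw_same_card)
  have sub: "sum_mset N = sum_mset (N - odd_parts k) + k\<^sup>2" if "odd_parts k \<subseteq># N" for N
    by (metis sum_odd_parts subset_mset.diff_add sum_mset.union that)
  show ?thesis
  proof (cases "k\<^sup>2 \<le> n")
    case True
    have odd_le: "x \<le> k\<^sup>2" "0 < x" if "x \<in># odd_parts k" for x
    proof -
      show "x \<le> k\<^sup>2" using that by (metis le_add1 multi_member_split sum_mset.add_mset sum_odd_parts)
      show "0 < x" using that by (auto simp: odd_parts_def)
    qed
    \<comment> \<open>The size bound stays \<open>n\<close>, since the odd parts put back may exceed
      n - k^2.\<close>
    have "bij_betw (\<lambda>(N, S). (N + odd_parts k, S)) (split_overpartitions n (n - k\<^sup>2)) A"
    proof (rule bij_betw_byWitness[where f' = "\<lambda>(N, S). (N - odd_parts k, S)"])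
      show "(\<lambda>(N, S). (N + odd_parts k, S)) ` split_overpartitions n (n - k\<^sup>2) \<subseteq> A"
      proof clarify
        fix N S assume "(N, S) \<in> split_overpartitions n (n - k\<^sup>2)"
        then show "(N + odd_parts k, S) \<in> A"
          using True odd_le order_trans[OF odd_le(1) True]
          by (auto simp: A_def split_overpartitions_def sum_odd_parts)
      qed
      show "(\<lambda>(N, S). (N - odd_parts k, S)) ` A \<subseteq> split_overpartitions n (n - k\<^sup>2)"
      proof clarify
        fix N S assume *: "(N, S) \<in> A"
        have "sum_mset N = sum_mset (N - odd_parts k) + k\<^sup>2"
          using * by (intro sub) (simp add: A_def)
        then show "(N - odd_parts k, S) \<in> split_overpartitions n (n - k\<^sup>2)"
          using * by (auto simp: A_def split_overpartitions_def dest!: in_diffD)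
      qed
    qed (auto simp: A_def)
    then have "card A = card (split_overpartitions n (n - k\<^sup>2))"
      by (simp add: bij_betw_same_card)
    then show ?thesis using 1 True by (simp add: card_split_overpartitions of_nat_diff)
  next
    case False
    \<comment> \<open>The removed parts alone would exceed n; on the other side \<open>pbar\<close>
      is 0 at negative arguments.\<close>
    then have "A = {}" by (auto simp: A_def split_overpartitions_def dest: sub)
    moreover have "int n < int k ^ 2" using False by (simp flip: of_nat_power)
    ultimately show ?thesis using 1 by (simp add: pbar_def)
  qed
qed

text \<open>Modulo 4 the residues of 2k + 1 and 2k + 3 share out the odd numbers. The stricter bound
  in the second class loses nothing, because 2k + 1 itself lies in the first.\<close>

lemma op21_add_op21_Suc: "op21 n k + op21 n (Suc k) = pbar (int n - int k ^ 2)"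
proof -
  define P where "P k x \<longleftrightarrow> x \<ge> 2 * k + 1 \<and> x mod 4 = (2 * k + 1) mod 4" for k x :: nat
  have ex: "\<not> (P k x \<and> P (Suc k) x)" for x
  proof -
    have "(2 * k + 1) mod 4 \<noteq> (2 * Suc k + 1) mod 4" by presburger
    then show ?thesis by (auto simp: P_def)
  qed
  have iff: "P k x \<or> P (Suc k) x \<longleftrightarrow> 2 * k + 1 \<le> x" if "odd x" for x
  proof (cases "2 * k + 1 \<le> x")
    case True
    then obtain d where d: "x = 2 * k + 1 + d" using le_Suc_ex by blast
    with \<open>odd x\<close> obtain j where j: "d = 2 * j" by auto
    show ?thesis
    proof (cases "even j")
      case True
      then obtain i where "j = 2 * i" by auto
      then have "x = 2 * k + 1 + 4 * i" using d j by simp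
      then show ?thesis by (simp add: P_def)
    next
      case False
      then obtain i where "j = 2 * i + 1" by (rule oddE)
      then have "x = 2 * Suc k + 1 + 4 * i" using d j by simp
      then have "P (Suc k) x" unfolding P_def by (metis le_add1 mod_mult_self2)
      then show ?thesis using True by simp
    qed
  qed (auto simp: P_def)
  have "{\<pi> \<in> overpartitions n. 2 * k + 1 \<le> mexbar21 \<pi>}
      = {\<pi> \<in> overpartitions n. P k (mexbar21 \<pi>)} \<union> {\<pi> \<in> overpartitions n. P (Suc k) (mexbar21 \<pi>)}"
    using iff[OF mexbar21(1)] by blast
  moreover have "{\<pi> \<in> overpartitions n. P k (mexbar21 \<pi>)} \<inter> {\<pi> \<in> overpartitions n. P (Suc k) (mexbar21 \<pi>)} = {}"
    using ex by auto
  ultimately have "card {\<pi> \<in> overpartitions n. 2 * k + 1 \<le> mexbar21 \<pi>}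
     = card {\<pi> \<in> overpartitions n. P k (mexbar21 \<pi>)} + card {\<pi> \<in> overpartitions n. P (Suc k) (mexbar21 \<pi>)}"
    by (simp add: card_Un_disjoint finite_overpartitions)
  then show ?thesis unfolding op21_def card_mexbar21_ge P_def by simp
qed

section \<open>Generating functions and Gauss's identity\<close>

text \<open>Every factor beyond the c-th is 1 modulo Q^(c+1).\<close>

lemma qpoch_diff_dvd:
  assumes "c \<le> a"
  shows "Q ^ Suc c dvd qpoch Q a - qpoch Q c"
  using assms
proof (induction a rule: dec_induct)
  case (step a)
  have "qpoch Q (Suc a) - qpoch Q c = (qpoch Q a - qpoch Q c) - Q ^ Suc a * qpoch Q a"
    by (simp add: qpoch_Suc algebra_simps)
  moreover have "Q ^ Suc c dvd Q ^ Suc a * qpoch Q a"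
    using step.hyps by (intro dvd_mult2 le_imp_power_dvd) auto
  ultimately show ?case using step.IH by (metis dvd_diff)
qed simp

lemma prod_one_plus_qpoch:
  "(\<Prod>i = 1..n. (1 + q ^ i)) * qpoch q n = qpoch (q\<^sup>2) n"
  unfolding qpoch_def prod.distrib[symmetric]
  by (rule prod.cong) (simp_all add: power_mult[symmetric] algebra_simps power_add[symmetric] mult_2_right)

lemma qpoch_double:
  "qpoch q (2 * n) = (\<Prod>i<n. (1 - q ^ (2 * i + 1))) * qpoch (q\<^sup>2) n"
proof (induction n)
  case (Suc n)
  have "qpoch q (2 * Suc n) = qpoch q (2 * n) * (1 - q ^ (2 * n + 1)) * (1 - q ^ (2 * Suc n))"
    by (simp add: qpoch_Suc)
  also have "q ^ (2 * Suc n) = (q\<^sup>2) ^ Suc n" by (rule power_mult)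
  finally show ?case unfolding Suc by (simp only: qpoch_Suc prod.lessThan_Suc mult_ac)
qed simp

text \<open>Bounding the sizes keeps the product formula finite; up to degree \<open>L\<close> the
  coefficients are still the values of \<open>pbar\<close>.\<close>

definition op_gf :: "nat \<Rightarrow> real fps" where
  "op_gf L = Abs_fps (\<lambda>n. real (card (split_overpartitions L n)))"

lemma op_gf_Suc: "op_gf (Suc L) * (1 - fps_X ^ Suc L) = op_gf L * (1 + fps_X ^ Suc L)"
proof (rule fps_ext)
  fix n
  have "fps_nth (op_gf (Suc L) * fps_X ^ Suc L) n = (if n < Suc L then 0 else card (split_overpartitions (Suc L) (n - Suc L)))"
    "fps_nth (op_gf L * fps_X ^ Suc L) n = (if n < Suc L then 0 else card (split_overpartitions L (n - Suc L)))"
    unfolding fps_X_power_mult_right_nth by (simp_all add: op_gf_def)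
  then show "fps_nth (op_gf (Suc L) * (1 - fps_X ^ Suc L)) n = fps_nth (op_gf L * (1 + fps_X ^ Suc L)) n"
    unfolding right_diff_distrib distrib_left fps_sub_nth fps_add_nth
    by (simp add: op_gf_def card_split_overpartitions_Suc)
qed

lemma op_gf_mult_qpoch: "op_gf L * qpoch fps_X L = (\<Prod>i = 1..L. (1 + fps_X ^ i))"
proof (induction L)
  case 0
  show ?case by (rule fps_ext) (simp add: op_gf_def split_overpartitions_0)
next
  case (Suc L)
  have "op_gf (Suc L) * qpoch fps_X (Suc L) = (op_gf (Suc L) * (1 - fps_X ^ Suc L)) * qpoch fps_X L"
    by (simp add: qpoch_Suc mult_ac)
  also have "\<dots> = (op_gf L * qpoch fps_X L) * (1 + fps_X ^ Suc L)"
    unfolding op_gf_Suc by (simp only: mult_ac)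
  finally show ?case unfolding Suc by simp
qed

text \<open>The constant term is 1. This permits cancelling such a product in a divisibility by a
  power of X.\<close>

lemma qpoch_fps_X_unit:
  assumes "k > 0"
  shows "is_unit (qpoch (fps_X ^ k :: real fps) n)"
proof -
  have "fps_nth (qpoch (fps_X ^ k :: real fps) n) 0 = 1"
    using assms by (induction n) (simp_all add: qpoch_Suc power_mult[symmetric])
  then show ?thesis by simp
qed

text \<open>With k = N + j this is the sum of (-1)^j X^(j^2) over |j| <= N.\<close>

definition theta_partial :: "nat \<Rightarrow> real fps" where
  "theta_partial N = (\<Sum>k\<le>2 * N. (-1) ^ (N + k) * fps_X ^ nat ((int k - int N)\<^sup>2))"

text \<open>The product formula gives \<open>F (2 * N) = O' * (F N)\<^sup>2 * R\<^sup>2\<close>.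
  After expanding \<open>R\<^sup>2\<close> by \<open>finite_Jacobi\<close>, each
  \<open>B k * (F N)\<^sup>2\<close> may be replaced by \<open>F (2 * N)\<close> modulo X^(2N+1),
  and the unit \<open>F (2 * N)\<close> cancels.\<close>

lemma op_gf_theta:
  assumes "N > 0"
  shows "fps_X ^ (2 * N + 1) dvd op_gf (2 * N) * theta_partial N - 1"
proof -
  define X where "X = (fps_X :: real fps)"
  define O' where "O' = op_gf (2 * N)"
  define F where "F = qpoch (X\<^sup>2)"
  define R where "R = (\<Prod>i<N. (1 - X ^ (2 * i + 1)))"
  define B where "B = qbinom (X\<^sup>2) (2 * N)"
  define s where "s k = (-1) ^ (N + k) * X ^ nat ((int k - int N)\<^sup>2)" for k
  have J: "R\<^sup>2 = (\<Sum>k\<le>2 * N. s k * B k)"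
    unfolding R_def B_def s_def by (rule finite_Jacobi) (use assms in \<open>auto simp: X_def\<close>)
  have "O' * (qpoch X (2 * N))\<^sup>2 = F (2 * N)"
    unfolding O'_def F_def X_def power2_eq_square mult.assoc[symmetric] op_gf_mult_qpoch
    using prod_one_plus_qpoch[of "fps_X :: real fps"] by (simp add: power2_eq_square)
  then have "F (2 * N) = O' * (F N)\<^sup>2 * R\<^sup>2"
    unfolding qpoch_double R_def F_def by (simp add: power_mult_distrib mult_ac)
  then have 1: "F (2 * N) = O' * (\<Sum>k\<le>2 * N. s k * (B k * (F N)\<^sup>2))"
    unfolding J by (simp add: sum_distrib_left mult_ac)
  have 2: "X ^ (2 * N + 1) dvd s k * (F (2 * N) - B k * (F N)\<^sup>2)" if "k \<le> 2 * N" for k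
  proof -
    \<comment> \<open>All of \<open>F k\<close>, \<open>F (2 * N - k)\<close>, \<open>F N\<close> agree with \<open>F c\<close> up to order \<open>2 * (c + 1)\<close>. With \<open>D = N - c\<close>,
      the factor \<open>X ^ D\<^sup>2\<close> in \<open>s k\<close> makes up the difference to \<open>2 * N + 1\<close>, as \<open>(D - 1)\<^sup>2 \<ge> 0\<close>.\<close>
    define c where "c = min k (2 * N - k)"
    have c: "c \<le> k" "c \<le> 2 * N - k" "c \<le> N" using that by (auto simp: c_def)
    have d: "(X\<^sup>2) ^ Suc c dvd F a - F c" if "c \<le> a" for a
      unfolding F_def by (rule qpoch_diff_dvd) fact
    \<comment> \<open>Each summand on the right contains a difference of some \<open>F a\<close>
      with \<open>F c\<close>; multiplied by \<open>B k\<close>, the product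
      \<open>F k * F (2 * N - k)\<close> becomes \<open>F (2 * N)\<close>.\<close>
    have "F k * F (2 * N - k) - (F N)\<^sup>2
      = F k * (F (2 * N - k) - F c) + (F k - F c) * F c - (F N + F c) * (F N - F c)"
      by (simp add: algebra_simps power2_eq_square)
    also have "(X\<^sup>2) ^ Suc c dvd \<dots>"
      using c by (intro dvd_diff[OF dvd_add[OF dvd_mult[OF d] dvd_mult2[OF d]] dvd_mult[OF d]])
    finally have "(X\<^sup>2) ^ Suc c dvd B k * (F k * F (2 * N - k) - (F N)\<^sup>2)"
      by (rule dvd_mult)
    also have "B k * (F k * F (2 * N - k) - (F N)\<^sup>2) = F (2 * N) - B k * (F N)\<^sup>2"
      using qbinom_qpoch[OF that, of "X\<^sup>2"] by (simp add: B_def F_def algebra_simps)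
    finally have "X ^ nat ((int k - int N)\<^sup>2) * X ^ (2 * Suc c) dvd s k * (F (2 * N) - B k * (F N)\<^sup>2)"
      unfolding s_def power_mult by (intro mult_dvd_mono) auto
    moreover have "2 * N + 1 \<le> nat ((int k - int N)\<^sup>2) + 2 * Suc c"
    proof -
      define D where "D = \<bar>int k - int N\<bar>"
      define t where "t = (int k - int N)\<^sup>2"
      have "int c = int N - D" using that by (auto simp: c_def D_def)
      moreover have "(D - 1)\<^sup>2 = t - 2 * D + 1"
        unfolding D_def t_def by (subst power2_diff) simp
      then have "0 \<le> t - 2 * D + 1" by (metis zero_le_power2)
      moreover have "int (nat t) = t" by (simp add: t_def)
      ultimately have "int (2 * N + 1) \<le> int (nat t + 2 * Suc c)"
        unfolding of_nat_add of_nat_mult of_nat_Suc of_nat_numeral of_nat_1 by simp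
      then show ?thesis by (simp only: of_nat_le_iff t_def)
    qed
    ultimately show ?thesis
      unfolding power_add[symmetric] by (rule dvd_trans[OF le_imp_power_dvd, rotated])
  qed
  have "(O' * (\<Sum>k\<le>2 * N. s k) - 1) * F (2 * N)
      = O' * (\<Sum>k\<le>2 * N. s k * F (2 * N)) - F (2 * N)"
    by (simp add: algebra_simps sum_distrib_left)
  also have "\<dots> = O' * (\<Sum>k\<le>2 * N. s k * (F (2 * N) - B k * (F N)\<^sup>2))"
    \<comment> \<open>Only the subtracted \<open>F (2 * N)\<close> is expanded, so that the two sums
      can be compared term by term.\<close>
    by (subst (2) 1) (simp add: right_diff_distrib sum_subtractf)
  also have "X ^ (2 * N + 1) dvd \<dots>"
    by (rule dvd_mult, rule dvd_sum, rule 2) simp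
  finally have "X ^ (2 * N + 1) dvd O' * (\<Sum>k\<le>2 * N. s k) - 1"
    unfolding F_def X_def using dvd_mult_unit_iff[OF qpoch_fps_X_unit] by simp
  then show ?thesis
    by (simp add: O'_def X_def s_def theta_partial_def)
qed

text \<open>Compares coefficients of X^n in \<open>op_gf_theta\<close> at N = n: n lies below the
  order 2n + 1, the constant 1 contributes nothing as n > 0, and the size bound 2n does not affect
  the coefficients involved.\<close>

lemma alternating_sum_pbar_eq_0:
  assumes "n > 0"
  shows "(\<Sum>j = - int n..int n. (-1) powi j * real (pbar (int n - j ^ 2))) = 0"
proof -
  define S where "S = (\<Sum>k\<le>2 * n. (-1) ^ (n + k) * real (pbar (int n - (int k - int n)\<^sup>2)))"
  obtain g where g: "op_gf (2 * n) * theta_partial n - 1 = fps_X ^ (2 * n + 1) * g"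
    using op_gf_theta[OF assms] by (elim dvdE)
  have "fps_nth (op_gf (2 * n) * theta_partial n - 1) n = 0"
    unfolding g fps_X_power_mult_nth by simp
  then have 0: "fps_nth (op_gf (2 * n) * theta_partial n) n = 0"
    using assms by simp
  have coeff: "fps_nth (op_gf (2 * n) * ((-1) ^ m * fps_X ^ nat i)) n = (-1) ^ m * real (pbar (int n - i))"
    if "i \<ge> 0" for m i
  proof -
    have "op_gf (2 * n) * ((-1) ^ m * fps_X ^ nat i) = fps_const ((-1) ^ m) * (op_gf (2 * n) * fps_X ^ nat i)"
      by (simp add: mult_ac flip: fps_const_power fps_const_neg)
    then have "fps_nth (op_gf (2 * n) * ((-1) ^ m * fps_X ^ nat i)) n
       = (-1) ^ m * (if n < nat i then 0 else fps_nth (op_gf (2 * n)) (n - nat i))"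
      by (simp only: fps_mult_left_const_nth fps_X_power_mult_right_nth)
    also have "\<dots> = (-1) ^ m * real (pbar (int n - i))"
    proof (cases "n < nat i")
      case True
      then show ?thesis by (simp add: pbar_def)
    next
      case False
      then have "int (n - nat i) = int n - i" using that by linarith
      then show ?thesis using False
        by (simp add: op_gf_def card_split_overpartitions)
    qed
    finally show ?thesis .
  qed
  have "S = fps_nth (op_gf (2 * n) * theta_partial n) n"
    unfolding theta_partial_def sum_distrib_left fps_sum_nth S_def
    by (rule sum.cong[OF refl], rule coeff[symmetric]) simp
  moreover have "(\<Sum>j = - int n..int n. (-1) powi j * real (pbar (int n - j ^ 2))) = S"
    unfolding S_def
  proof (rule sum.reindex_bij_witness[of _ "\<lambda>k. int k - int n" "\<lambda>j. nat (j + int n)"])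
    fix j assume "j \<in> {- int n..int n}"
    then have k: "int (nat (j + int n)) = j + int n" by auto
    \<comment> \<open>The exponents differ by 2n, so the signs agree.\<close>
    have "(-1 :: real) powi j = (-1) powi (int (n + nat (j + int n)))"
      unfolding of_nat_add k by (simp add: power_int_minus_left)
    then show "(-1) ^ (n + nat (j + int n)) * real (pbar (int n - (int (nat (j + int n)) - int n)\<^sup>2))
        = (-1) powi j * real (pbar (int n - j ^ 2))"
      unfolding k power_int_of_nat by simp
  qed auto
  ultimately show ?thesis using 0 by simp
qed

section \<open>Telescoping and the sign cases\<close>

text \<open>By \<open>op21_add_op21_Suc\<close> neighbouring terms cancel. The empty interval a = b
  + 1 is included, where the two end terms cancel; \<open>sum_pbar_across_0\<close> needs it when
  its \<open>a\<close> is 0.\<close>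

lemma sum_pbar_telescope:
  assumes "a \<le> Suc b"
  shows "(\<Sum>j = int a..int b. (-1) powi j * real (pbar (int n - j ^ 2)))
     = (-1) ^ a * real (op21 n a) + (-1) ^ b * real (op21 n (Suc b))"
  using assms
proof (induction b)
  case 0
  show ?case
  proof (cases a)
    case 0
    then show ?thesis using op21_add_op21_Suc[of n 0] by simp
  next
    case (Suc a')
    then show ?thesis using 0 by simp
  qed
next
  case (Suc b)
  show ?case
  proof (cases "a = Suc (Suc b)")
    case False
    have "{int a..int (Suc b)} = insert (int (Suc b)) {int a..int b}"
      using Suc.prems False by auto
    then have "(\<Sum>j = int a..int (Suc b). (-1) powi j * real (pbar (int n - j ^ 2)))
       = (-1) powi (int (Suc b)) * real (pbar (int n - int (Suc b) ^ 2))
         + (\<Sum>j = int a..int b. (-1) powi j * real (pbar (int n - j ^ 2)))"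
      by (simp del: of_nat_Suc)
    also have "(\<Sum>j = int a..int b. (-1) powi j * real (pbar (int n - j ^ 2)))
       = (-1) ^ a * real (op21 n a) + (-1) ^ b * real (op21 n (Suc b))"
      using Suc.prems False by (intro Suc.IH) auto
    finally show ?thesis
      unfolding op21_add_op21_Suc[symmetric] power_int_of_nat by (simp add: algebra_simps)
  qed simp
qed

lemma sum_pbar_reflect:
  "(\<Sum>j = - k..- m. (-1) powi j * real (pbar (int n - j ^ 2)))
     = (\<Sum>j = m..k. (-1) powi j * real (pbar (int n - j ^ 2)))"
  by (rule sum.reindex_bij_witness[of _ uminus uminus]) (auto simp: power_int_minus_left)

text \<open>The range is cut before 0 and its negative half reflected. Both halves telescope, and
  their inner ends leave the defect \<open>op21 n 0 - op21 n 1\<close>.\<close>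

lemma sum_pbar_across_0:
  "(\<Sum>j = - int a..int b. (-1) powi j * real (pbar (int n - j ^ 2)))
     = real (op21 n 0) - real (op21 n 1)
       + (-1) ^ a * real (op21 n (Suc a)) + (-1) ^ b * real (op21 n (Suc b))"
proof -
  let ?f = "\<lambda>j. (-1) powi j * real (pbar (int n - j ^ 2))"
  have "{- int a..int b} = {- int a..- int 1} \<union> {int 0..int b}" by auto
  then have "sum ?f {- int a..int b} = sum ?f {- int a..- int 1} + sum ?f {int 0..int b}"
    by (simp add: sum.union_disjoint)
  also have "sum ?f {int 0..int b} = (-1) ^ 0 * real (op21 n 0) + (-1) ^ b * real (op21 n (Suc b))"
    by (rule sum_pbar_telescope) simp
  also have "sum ?f {- int a..- int 1} = (-1) ^ 1 * real (op21 n 1) + (-1) ^ a * real (op21 n (Suc a))"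
    unfolding sum_pbar_reflect by (rule sum_pbar_telescope) simp
  finally show ?thesis by simp
qed

text \<open>As k <= k^2, the right side of \<open>op21_add_op21_Suc\<close> is \<open>pbar\<close>
  at a negative argument.\<close>

lemma op21_eq_0: "n < k \<Longrightarrow> op21 n k = 0"
  using op21_add_op21_Suc[of n k] power_increasing[of 1 2 "int k"] by (simp add: pbar_def)

text \<open>The sum over -n..n vanishes, and so do its outer end terms
  \<open>op21 n (Suc n)\<close>; only the defect at 0 remains.\<close>

lemma op21_0_eq_op21_1:
  assumes "n > 0"
  shows "op21 n 0 = op21 n 1"
  using alternating_sum_pbar_eq_0[OF assms] sum_pbar_across_0[of n n n] by (simp add: op21_eq_0)

theorem theorem2p4:
  fixes n a b :: nat and m k :: int
  assumes "n \<ge> 1" and "m \<le> k"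
    and "a = nat (min \<bar>m\<bar> \<bar>k\<bar>)"
    and "b = nat (max \<bar>m\<bar> \<bar>k\<bar>)"
  shows "(m * k > 0 \<longrightarrow>
            (-1) powi (min \<bar>m\<bar> k) * (\<Sum>j = m..k. (-1) powi j * real (pbar (int n - j ^ 2)))
              = real (op21 n a) + (-1) powi (m + k) * real (op21 n (b + 1))) \<and>
         (m * k \<le> 0 \<longrightarrow>
            (-1) powi (min \<bar>m\<bar> k) * (\<Sum>j = m..k. (-1) powi j * real (pbar (int n - j ^ 2)))
              = real (op21 n (a + 1)) + (-1) powi (m + k) * real (op21 n (b + 1)))"
proof -
  let ?S = "\<Sum>j = m..k. (-1) powi j * real (pbar (int n - j ^ 2))"
  have same: "(-1) ^ p * ((-1) ^ p * x + (-1) ^ q * y) = x + (-1) ^ (p + q) * y" for p q and x y :: real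
    by (simp add: distrib_left power_add flip: mult.assoc power2_eq_square power_mult)
  consider (pos) "0 < m" | (neg) "k < 0" | (mixed) "m \<le> 0" "0 \<le> k" by linarith
  then show ?thesis
  proof cases
    case pos
    then have "m = int a" "k = int b" using assms(2-4) by simp_all
    then have "?S = (-1) ^ a * real (op21 n a) + (-1) ^ b * real (op21 n (Suc b))"
      using sum_pbar_telescope[of a b n] \<open>m \<le> k\<close> by simp
    moreover have "min \<bar>m\<bar> k = int a" "m + k = int (a + b)" "0 < m * k"
      using pos \<open>m \<le> k\<close> unfolding \<open>m = int a\<close> \<open>k = int b\<close> by simp_all
    ultimately show ?thesis by (simp only: power_int_of_nat same) simp
  next
    case neg
    then have "m = - int b" "k = - int a" using assms(2-4) by simp_all
    then have "?S = (-1) ^ a * real (op21 n a) + (-1) ^ b * real (op21 n (Suc b))"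
      using sum_pbar_telescope[of a b n] \<open>m \<le> k\<close> sum_pbar_reflect by simp
    \<comment> \<open>Here k is negative and is itself the minimum, so the exponents are negative;
      only their parity matters.\<close>
    moreover have "min \<bar>m\<bar> k = - int a" "m + k = - int (a + b)" "0 < m * k"
      using neg \<open>m \<le> k\<close> unfolding \<open>m = - int b\<close> \<open>k = - int a\<close> by simp_all
    moreover have "(-1 :: real) powi (- i) = (-1) powi i" for i
      by (simp add: power_int_minus_left)
    ultimately show ?thesis by (simp only: power_int_of_nat same) simp
  next
    case mixed
    define M where "M = nat (- m)"
    define K where "K = nat k"
    have mk: "m = - int M" "k = int K" using mixed by (auto simp: M_def K_def)
    \<comment> \<open>The defect at 0 cancels because n >= 1.\<close>
    have S: "?S = (-1) ^ M * real (op21 n (Suc M)) + (-1) ^ K * real (op21 n (Suc K))"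
      unfolding mk sum_pbar_across_0 using op21_0_eq_op21_1 \<open>n \<ge> 1\<close> by simp
    have sgn: "(-1 :: real) powi (m + k) = (-1) ^ (M + K)"
      unfolding mk by (simp add: power_int_minus_left flip: power_int_of_nat)
    have "\<not> 0 < m * k" using mixed by (simp add: mult_nonpos_nonneg not_less)
    moreover have "(-1) powi (min \<bar>m\<bar> k) * ?S = real (op21 n (a + 1)) + (-1) powi (m + k) * real (op21 n (b + 1))"
    proof (cases "M \<le> K")
      case True
      then have "a = M" "b = K" "min \<bar>m\<bar> k = int M" unfolding assms(3,4) mk by simp_all
      then show ?thesis unfolding S sgn by (simp only: power_int_of_nat same) simp
    next
      case False
      then have "a = K" "b = M" "min \<bar>m\<bar> k = int K" unfolding assms(3,4) mk by simp_all
      then show ?thesis unfolding S sgn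
        \<comment> \<open>Now the end term with index \<open>Suc K\<close> carries the smaller
          index, so the two end terms change places before the sign is absorbed.\<close>
        by (subst add.commute) (simp only: power_int_of_nat same, simp add: add.commute)
    qed
    ultimately show ?thesis by simp
  qed
qed

end
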